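(* Let $\mathcal H$ be a complex Hilbert space (of arbitrary dimension) and let $T$ be a bounded operator on $\mathcal H$ with $W(T)\subset\mathcal S_{\pi/4}=\{re^{i\theta}:r\ge0,\ |\theta|\le\pi/4\}$. For every $u>0$, $$\bigl\|(T^4-uT^2+I)(T^4+uT^2+I)^{-1}\bigr\|\le\sqrt2 .$$ Consequently, for every degree-two Blaschke product $F$ on the right half-plane whose two zeros are either both positive real or form a complex conjugate pair, one has $\|F(T^2)\|\le\sqrt2$.
   Context: $W(T)=\{\langle Tx,x\rangle:\|x\|=1\}$ is the numerical range. A degree-two Blaschke product on the right half-plane $\{z:\Re z>0\}$ is a function $F(z)=\omega\,\frac{z-\zeta_1}{z+\overline{\zeta_1}}\cdot\frac{z-\zeta_2}{z+\overline{\zeta_2}}$ with $|\omega|=1$ and $\Re\zeta_1,\Re\zeta_2>0$. *)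

theory Defs
  imports
    "HOL-Analysis.Bounded_Linear_Function"
    "HOL-Analysis.Complex_Transcendental"
    "HOL-Computational_Algebra.Polynomial"
begin

text \<open>
  Complex Hilbert spaces. The base class \<^class>\<open>banach\<close> provides the norm, its topology, completeness
  and the underlying real vector space; the last axiom says that the norm is the one induced by the
  inner product, so positive definiteness of \<open>cinner\<close> follows from the norm axioms. The inner product
  is linear in its first argument.
\<close>

class complex_hilbert_space = banach +
  fixes scaleC :: "complex \<Rightarrow> 'a \<Rightarrow> 'a"  (infixr \<open>*\<^sub>C\<close> 75)
    and cinner :: "'a \<Rightarrow> 'a \<Rightarrow> complex"
  assumes scaleC_add_right: "c *\<^sub>C (x + y) = c *\<^sub>C x + c *\<^sub>C y"
    and scaleC_add_left: "(c + d) *\<^sub>C x = c *\<^sub>C x + d *\<^sub>C x"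
    and scaleC_scaleC: "c *\<^sub>C (d *\<^sub>C x) = (c * d) *\<^sub>C x"
    and scaleR_scaleC: "r *\<^sub>R x = complex_of_real r *\<^sub>C x"
    and cinner_commute: "cinner x y = cnj (cinner y x)"
    and cinner_add_left: "cinner (x + y) z = cinner x z + cinner y z"
    and cinner_scaleC_left: "cinner (c *\<^sub>C x) y = c * cinner x y"
    and cinner_self: "cinner x x = complex_of_real ((norm x)\<^sup>2)"

instantiation complex :: complex_hilbert_space
begin

definition scaleC_complex :: "complex \<Rightarrow> complex \<Rightarrow> complex"
  where "scaleC_complex c x = c * x"

definition cinner_complex :: "complex \<Rightarrow> complex \<Rightarrow> complex"
  where "cinner_complex x y = x * cnj y"

instance
  by standard
    (simp_all add: scaleC_complex_def cinner_complex_def algebra_simps scaleR_conv_of_real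
      complex_norm_square del: of_real_power)

end

lemma norm_scaleC: "norm (c *\<^sub>C x) = cmod c * norm (x :: 'a :: complex_hilbert_space)"
proof -
  have "cinner (c *\<^sub>C x) (c *\<^sub>C x) = c * cnj c * cinner x x"
    by (metis cinner_commute cinner_scaleC_left complex_cnj_mult mult.assoc)
  then have "complex_of_real ((norm (c *\<^sub>C x))\<^sup>2) = complex_of_real ((cmod c * norm x)\<^sup>2)"
    by (simp only: cinner_self complex_norm_square[symmetric] of_real_mult power_mult_distrib)
  then have "(norm (c *\<^sub>C x))\<^sup>2 = (cmod c * norm x)\<^sup>2"
    by (simp only: of_real_eq_iff)
  then show ?thesis
    by (simp add: power2_eq_iff_nonneg)
qed

text \<open>
  Bounded operators are elements of \<^typ>\<open>'a \<Rightarrow>\<^sub>L 'a\<close>, whose members are only real-linear;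
  complex linearity is the predicate \<open>clinear_op\<close>. The norm of \<^typ>\<open>'a \<Rightarrow>\<^sub>L 'a\<close> is the operator norm,
  and a two-sided inverse of a complex-linear operator is automatically complex-linear.
\<close>

definition clinear_op :: "('a::complex_hilbert_space \<Rightarrow>\<^sub>L 'a) \<Rightarrow> bool"
  where "clinear_op T \<longleftrightarrow> (\<forall>c x. blinfun_apply T (c *\<^sub>C x) = c *\<^sub>C blinfun_apply T x)"

definition numerical_range :: "('a::complex_hilbert_space \<Rightarrow>\<^sub>L 'a) \<Rightarrow> complex set"
  where "numerical_range T = {cinner (blinfun_apply T x) x |x. norm x = 1}"

definition sector :: "real \<Rightarrow> complex set"
  where "sector \<alpha> = {complex_of_real r * exp (\<i> * complex_of_real \<theta>) |r \<theta>. 0 \<le> r \<and> \<bar>\<theta>\<bar> \<le> \<alpha>}"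

lift_definition scaleC_op ::
  "complex \<Rightarrow> ('a::complex_hilbert_space \<Rightarrow>\<^sub>L 'a) \<Rightarrow> ('a \<Rightarrow>\<^sub>L 'a)"
  is "\<lambda>c T x. c *\<^sub>C T x"
proof -
  fix c :: complex and T :: "'a \<Rightarrow> 'a"
  assume "bounded_linear T"
  then interpret T: bounded_linear T .
  obtain K where K: "\<And>x. norm (T x) \<le> norm x * K"
    using T.bounded by blast
  show "bounded_linear (\<lambda>x. c *\<^sub>C T x)"
  proof (rule bounded_linear_intro[where K = "cmod c * K"])
    show "norm (c *\<^sub>C T x) \<le> norm x * (cmod c * K)" for x
      using mult_left_mono[OF K, of "cmod c" x] by (simp add: norm_scaleC algebra_simps)
  qed (simp_all add: T.add T.scaleR scaleC_add_right, simp add: scaleR_scaleC scaleC_scaleC mult.commute)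
qed

primrec op_power :: "('a::real_normed_vector \<Rightarrow>\<^sub>L 'a) \<Rightarrow> nat \<Rightarrow> ('a \<Rightarrow>\<^sub>L 'a)" where
  "op_power T 0 = id_blinfun"
| "op_power T (Suc n) = T o\<^sub>L op_power T n"

definition invertible_op :: "('a::real_normed_vector \<Rightarrow>\<^sub>L 'a) \<Rightarrow> bool"
  where "invertible_op A \<longleftrightarrow> (\<exists>B. A o\<^sub>L B = id_blinfun \<and> B o\<^sub>L A = id_blinfun)"

definition op_inverse :: "('a::real_normed_vector \<Rightarrow>\<^sub>L 'a) \<Rightarrow> ('a \<Rightarrow>\<^sub>L 'a)"
  where "op_inverse A = (THE B. A o\<^sub>L B = id_blinfun \<and> B o\<^sub>L A = id_blinfun)"

definition poly_op :: "complex poly \<Rightarrow> ('a::complex_hilbert_space \<Rightarrow>\<^sub>L 'a) \<Rightarrow> ('a \<Rightarrow>\<^sub>L 'a)"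
  where "poly_op p A = (\<Sum>i\<le>degree p. scaleC_op (coeff p i) (op_power A i))"

text \<open>
  Rational functional calculus: \<open>rational_value F A B\<close> says that \<open>F\<close> is a rational function \<open>p / q\<close>
  with \<open>q(A)\<close> invertible and that \<open>B = p(A) q(A)\<inverse>\<close>. For complex-linear \<open>A\<close> there is at most one
  such \<open>B\<close>, because two representations of \<open>F\<close> agree after cross-multiplication; it is denoted by
  \<open>apply_op F A\<close>.
\<close>

definition rational_value ::
  "(complex \<Rightarrow> complex) \<Rightarrow> ('a::complex_hilbert_space \<Rightarrow>\<^sub>L 'a) \<Rightarrow> ('a \<Rightarrow>\<^sub>L 'a) \<Rightarrow> bool"
  where "rational_value F A B \<longleftrightarrow>
    (\<exists>p q. q \<noteq> 0 \<and> (\<forall>z. poly q z \<noteq> 0 \<longrightarrow> F z = poly p z / poly q z) \<and>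
      invertible_op (poly_op q A) \<and> B = poly_op p A o\<^sub>L op_inverse (poly_op q A))"

definition apply_op ::
  "(complex \<Rightarrow> complex) \<Rightarrow> ('a::complex_hilbert_space \<Rightarrow>\<^sub>L 'a) \<Rightarrow> ('a \<Rightarrow>\<^sub>L 'a)"
  where "apply_op F A = (THE B. rational_value F A B)"

definition blaschke2 :: "complex \<Rightarrow> complex \<Rightarrow> complex \<Rightarrow> complex \<Rightarrow> complex"
  where "blaschke2 \<omega> \<zeta>\<^sub>1 \<zeta>\<^sub>2 z = \<omega> * ((z - \<zeta>\<^sub>1) / (z + cnj \<zeta>\<^sub>1)) * ((z - \<zeta>\<^sub>2) / (z + cnj \<zeta>\<^sub>2))"

end

theory Submission
  imports Defs
begin

text \<open>
  Put \<open>k = sqrt (u + 2)\<close>. The numerator \<open>z^4 - u z^2 + 1\<close> factors as \<open>(z^2 - k z + 1) (z^2 + k z + 1)\<close>,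
  the first factor carrying its zeros in the right half-plane. With \<open>p = T^4 w + w\<close> and
  \<open>q = u T^2 w\<close> the desired estimate says that
  \<open>2 |p + q|^2 - |p - q|^2 = |p|^2 + |q|^2 + 6 Re (p, q)\<close> is nonnegative. The proof subtracts
  \<open>|(T^2 - k T + 1)^2 w|^2\<close> from this expression and shows that the remainder is a nonnegative
  combination of values of a form that the numerical range hypothesis makes positive.

  That form arises as follows. The hypothesis says that \<open>Re (\<omega> (T y, y))\<close> is nonnegative for
  \<open>\<omega> = exp (\<plusminus>i pi/4)\<close>. Adding the inequality at \<open>y = a + i b\<close> for one sign to that at \<open>y = a - i b\<close>
  for the other gives, for the real inner product \<open>(x | y) = Re (x, y)\<close>, the inequality
  \<open>(Ta | a) + (Tb | b) + (Ta | b) - (Tb | a) \<ge> 0\<close>, whose left-hand side is a positive real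
  quadratic form in the pair \<open>(a, b)\<close> (\<open>sector_form_nonneg\<close>). The remainder comes from pairing this
  form, evaluated at four pairs built from \<open>w, Tw, T^2 w, T^3 w\<close>, with a symmetric 4 by 4 matrix of
  coefficients depending on \<open>k\<close> (\<open>certificate_identity\<close>). The matrix is positive semidefinite: a
  Schur complement splits it into two 2 by 2 blocks (\<open>certificate_schur_identity\<close>), whose
  determinants are \<open>k^6 - 8 u^2\<close> and \<open>u^2 (k^6 - 8 u^2)\<close> up to positive factors, and
  \<open>k^6 - 8 u^2 = (u + 2)^3 - 8 u^2\<close> is positive for \<open>u > 0\<close>.

  Replacing \<open>T\<close> by a positive multiple turns \<open>T^4 \<plusminus> u T^2 + 1\<close> into \<open>T^4 \<plusminus> \<sigma> T^2 + \<rho>\<close> with arbitrary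
  \<open>\<sigma>, \<rho> > 0\<close>. The resulting inequality also bounds \<open>T^4 + \<sigma> T^2 + \<rho>\<close> from below, uniformly along the path
  \<open>s T\<close> with \<open>0 \<le> s \<le> 1\<close>; at \<open>s = 0\<close> the operator is \<open>\<rho>\<close>, so the method of continuity yields
  invertibility at \<open>s = 1\<close>. For the zeros allowed in the second claim,
  a Blaschke product is a unimodular multiple of \<open>(z^2 - \<sigma> z + \<rho>) / (z^2 + \<sigma> z + \<rho>)\<close>, so
  that claim is the first one, once the rational functional calculus is known to be single-valued.
\<close>

section \<open>The real inner product\<close>

definition rdot :: "'a::complex_hilbert_space \<Rightarrow> 'a \<Rightarrow> real" where
  "rdot x y = Re (cinner x y)"

lemma rdot_commute: "rdot x y = rdot y x"
  unfolding rdot_def by (subst cinner_commute) simp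

lemma rdot_add_left: "rdot (x + y) z = rdot x z + rdot y z"
  by (simp add: rdot_def cinner_add_left)

lemma rdot_scaleR_left: "rdot (r *\<^sub>R x) y = r * rdot x y"
  by (simp add: rdot_def scaleR_scaleC cinner_scaleC_left)

lemma rdot_add_right: "rdot z (x + y) = rdot z x + rdot z y"
  by (metis rdot_add_left rdot_commute)

lemma rdot_scaleR_right: "rdot y (r *\<^sub>R x) = r * rdot y x"
  by (metis rdot_scaleR_left rdot_commute)

lemma rdot_diff_left: "rdot (x - y) z = rdot x z - rdot y z"
  using rdot_add_left[of x "(-1) *\<^sub>R y" z] rdot_scaleR_left[of "-1" y z] by simp

lemma rdot_diff_right: "rdot z (x - y) = rdot z x - rdot z y"
  by (metis rdot_diff_left rdot_commute)

lemma rdot_zero [simp]: "rdot 0 x = 0" "rdot x 0 = 0"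
  using rdot_scaleR_left[of 0 x x] rdot_scaleR_right[of x 0 x] by simp_all

lemma rdot_self: "rdot x x = (norm x)\<^sup>2"
  by (simp add: rdot_def cinner_self del: of_real_power)

lemmas rdot_simps = rdot_add_left rdot_add_right rdot_diff_left rdot_diff_right
  rdot_scaleR_left rdot_scaleR_right

section \<open>The numerical range condition as a positive real form\<close>

definition quarter_sectorial :: "('a::complex_hilbert_space \<Rightarrow>\<^sub>L 'a) \<Rightarrow> bool" where
  "quarter_sectorial T \<longleftrightarrow> (\<forall>a b. 0 \<le> rdot (T a) a + rdot (T b) b + rdot (T a) b - rdot (T b) a)"

lemma sector_quarter_abs_Im_le:
  assumes "z \<in> sector (pi / 4)"
  shows "\<bar>Im z\<bar> \<le> Re z"
proof -
  obtain r \<theta> where z: "z = complex_of_real r * exp (\<i> * complex_of_real \<theta>)"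
    and r: "0 \<le> r" and \<theta>: "\<bar>\<theta>\<bar> \<le> pi / 4"
    using assms by (auto simp: sector_def)
  have "0 \<le> sin \<bar>\<theta>\<bar>"
    using \<theta> pi_gt_zero by (intro sin_ge_zero) linarith+
  then have "\<bar>sin \<theta>\<bar> = sin \<bar>\<theta>\<bar>"
    by (cases "\<theta> \<ge> 0") auto
  also have "\<dots> \<le> sin (pi / 4)"
    using \<theta> by (intro sin_monotone_2pi_le) auto
  also have "\<dots> = cos (pi / 4)"
    by (simp add: sin_45 cos_45)
  also have "\<dots> \<le> cos \<bar>\<theta>\<bar>"
    using \<theta> by (intro cos_monotone_0_pi_le) auto
  finally have "\<bar>sin \<theta>\<bar> \<le> cos \<theta>"
    by simp
  then show ?thesis
    using r by (simp add: z Re_exp Im_exp abs_mult mult_left_mono)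
qed

text \<open>
  The inequality at \<open>a + i b\<close> for the ray at angle \<open>pi/4\<close> is added to the one at \<open>a - i b\<close> for the
  ray at angle \<open>-pi/4\<close>; the imaginary parts of the inner products cancel, and only real ones remain.
\<close>

lemma quarter_sectorialI:
  assumes T: "clinear_op T" and W: "numerical_range T \<subseteq> sector (pi / 4)"
  shows "quarter_sectorial T"
proof -
  have sector: "\<bar>Im (cinner (T y) y)\<bar> \<le> Re (cinner (T y) y)" for y
  proof (cases "y = 0")
    case True
    have "cinner 0 (0::'a) = 0"
      by (simp add: cinner_self)
    then show ?thesis
      by (simp add: True)
  next
    case False
    define x where "x = (1 / norm y) *\<^sub>R y"
    have "cinner (T x) x \<in> numerical_range T"
      using False by (auto simp: numerical_range_def x_def intro!: exI[of _ x])
    then have le: "\<bar>Im (cinner (T x) x)\<bar> \<le> Re (cinner (T x) x)"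
      using W sector_quarter_abs_Im_le by blast
    have y: "y = norm y *\<^sub>R x"
      using False by (simp add: x_def)
    have right: "cinner z (complex_of_real r *\<^sub>C x) = complex_of_real r * cinner z x" for z r
      by (metis cinner_commute cinner_scaleC_left complex_cnj_complex_of_real complex_cnj_mult)
    have "cinner (T y) y = cinner (norm y *\<^sub>R T x) (norm y *\<^sub>R x)"
      by (metis y blinfun.scaleR_right)
    also have "\<dots> = complex_of_real ((norm y)\<^sup>2) * cinner (T x) x"
      by (simp add: scaleR_scaleC cinner_scaleC_left right power2_eq_square)
    finally show ?thesis
      using le by (simp add: abs_mult mult_left_mono del: of_real_power)
  qed
  show ?thesis
    unfolding quarter_sectorial_def
  proof (intro allI)
    fix a b
    have right: "cinner x (c *\<^sub>C y) = cnj c * cinner x y" for x y :: 'a and c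
      by (metis cinner_commute cinner_scaleC_left complex_cnj_mult)
    have add: "cinner x (y + z) = cinner x y + cinner x z" for x y z :: 'a
      by (metis cinner_add_left cinner_commute complex_cnj_add)
    have expand: "cinner (T (a + c *\<^sub>C b)) (a + c *\<^sub>C b) =
        cinner (T a) a + c * cnj c * cinner (T b) b + c * cinner (T b) a + cnj c * cinner (T a) b" for c
      using T by (simp add: clinear_op_def blinfun.add_right cinner_add_left add right
          cinner_scaleC_left algebra_simps)
    show "0 \<le> rdot (T a) a + rdot (T b) b + rdot (T a) b - rdot (T b) a"
      using sector[of "a + \<i> *\<^sub>C b"] sector[of "a + (- \<i>) *\<^sub>C b"]
      unfolding expand rdot_def by simp
  qed
qed

lemma quarter_sectorial_scaleR:
  assumes "quarter_sectorial T" "0 \<le> c"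
  shows "quarter_sectorial (c *\<^sub>R T)"
  unfolding quarter_sectorial_def
proof (intro allI)
  fix a b
  have "0 \<le> c * (rdot (T a) a + rdot (T b) b + rdot (T a) b - rdot (T b) a)"
    using assms by (simp add: quarter_sectorial_def)
  then show "0 \<le> rdot ((c *\<^sub>R T) a) a + rdot ((c *\<^sub>R T) b) b + rdot ((c *\<^sub>R T) a) b - rdot ((c *\<^sub>R T) b) a"
    by (simp add: blinfun.scaleR_left rdot_simps algebra_simps)
qed

text \<open>
  As a function of two pairs the form is bilinear over the reals but not symmetric; only its symmetrization
  enters the estimates below.
\<close>

definition sector_form :: "('a::complex_hilbert_space \<Rightarrow>\<^sub>L 'a) \<Rightarrow> 'a \<times> 'a \<Rightarrow> 'a \<times> 'a \<Rightarrow> real" where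
  "sector_form T p q = rdot (T (fst p)) (fst q) + rdot (T (snd p)) (snd q)
     + rdot (T (fst p)) (snd q) - rdot (T (snd p)) (fst q)"

lemma sector_form_simps:
  "sector_form T (p + q) r = sector_form T p r + sector_form T q r"
  "sector_form T (p - q) r = sector_form T p r - sector_form T q r"
  "sector_form T r (p + q) = sector_form T r p + sector_form T r q"
  "sector_form T r (p - q) = sector_form T r p - sector_form T r q"
  "sector_form T (c *\<^sub>R p) q = c * sector_form T p q"
  "sector_form T p (c *\<^sub>R q) = c * sector_form T p q"
  by (simp_all add: sector_form_def blinfun.add_right blinfun.diff_right blinfun.scaleR_right
      rdot_simps algebra_simps)

lemma sector_form_nonneg: "quarter_sectorial T \<Longrightarrow> 0 \<le> sector_form T p p"
  by (simp add: quarter_sectorial_def sector_form_def)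

text \<open>
  Pairing a positive semidefinite 2 by 2 matrix with a positive form gives a nonnegative number. The matrix
  has diagonal \<open>t + y, t - y\<close> and off-diagonal entry \<open>z\<close>, which makes semidefiniteness the single
  condition that \<open>(y, z)\<close> has length at most \<open>t\<close>. The proof completes the square.
\<close>

lemma sector_form_pair_nonneg:
  assumes T: "quarter_sectorial T" and t: "0 \<le> t" "y\<^sup>2 + z\<^sup>2 \<le> t\<^sup>2"
  shows "0 \<le> (t + y) * sector_form T p p + z * (sector_form T p q + sector_form T q p)
            + (t - y) * sector_form T q q" (is "0 \<le> ?N")
proof (cases "t + y = 0")
  case True
  then have "y = - t" by simp
  with t have "z = 0" by simp
  then show ?thesis
    using t \<open>y = - t\<close> sector_form_nonneg[OF T, of q] by simp
next
  case False
  have "y\<^sup>2 \<le> t\<^sup>2"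
    using t by (smt (verit) zero_le_power2)
  then have "\<bar>y\<bar> \<le> t"
    using t(1) abs_le_square_iff[of y t] by simp
  with False have pos: "0 < t + y" by linarith
  have "0 \<le> sector_form T ((t + y) *\<^sub>R p + z *\<^sub>R q) ((t + y) *\<^sub>R p + z *\<^sub>R q)
      + (t\<^sup>2 - y\<^sup>2 - z\<^sup>2) * sector_form T q q"
    using t sector_form_nonneg[OF T] by (intro add_nonneg_nonneg mult_nonneg_nonneg) auto
  also have "\<dots> = (t + y) * ?N"
    by (simp add: sector_form_simps algebra_simps power2_eq_square)
  finally show ?thesis
    using pos by (simp add: zero_le_mult_iff)
qed

section \<open>The certificate\<close>

text \<open>
  The coefficients are the entries of \<open>k\<^sup>2\<close> times the positive semidefinite matrix behind the estimate,
  so that they are polynomials in \<open>k\<close>; the parameter \<open>m\<close> is \<open>k\<^sup>2 - 2\<close>, the \<open>u\<close> of the quartic.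
  Sums of \<open>Re (\<omega> (T y, y))\<close>, with \<open>y\<close> in the span of \<open>T^l w\<close> for \<open>l < 4\<close>, are given by positive
  semidefinite Hermitian 4 by 4 matrices. Since the quartic is palindromic, such a matrix can be
  sought invariant under complex conjugation combined with the reversal \<open>l \<mapsto> 3 - l\<close>. The vectors
  fixed by that symmetry form a real space of dimension 4, in which the Hermitian matrix becomes a real
  symmetric one; the vectors of that space correspond to the pairs \<open>f0, \<dots>, f3\<close> used below.
\<close>

definition certificate :: "real \<Rightarrow> ('b \<Rightarrow> 'b \<Rightarrow> real) \<Rightarrow> 'b \<Rightarrow> 'b \<Rightarrow> 'b \<Rightarrow> 'b \<Rightarrow> real" where
  "certificate k \<phi> f0 f1 f2 f3 = (let m = k\<^sup>2 - 2 in
     (k^3 - 2 * m) * \<phi> f0 f0 + (k^3 + 2 * m) * \<phi> f1 f1 + 2 * m * (\<phi> f0 f1 + \<phi> f1 f0)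
     + k\<^sup>2 * ((k - 2) * (\<phi> f0 f2 + \<phi> f2 f0) - m * (\<phi> f0 f3 + \<phi> f3 f0)
            + m * (\<phi> f1 f2 + \<phi> f2 f1) - (k + 2) * (\<phi> f1 f3 + \<phi> f3 f1))
     + (k^5 + k^3 - 2 * k^4 + 2 * m) * \<phi> f2 f2 + (k^5 + k^3 + 2 * k^4 - 2 * m) * \<phi> f3 f3
     + 2 * m * (\<phi> f2 f3 + \<phi> f3 f2))"

text \<open>
  The vector \<open>(T^2 - k T + 1)^2 v0\<close>, whose squared norm is subtracted here, vanishes for a 2 by 2 Jordan
  block \<open>T\<close> with eigenvalue at a zero of \<open>z^2 - k z + 1\<close>; this is why the factor is squared. Jordan
  blocks are what forces the constant: for \<open>(z^2 - 1) / (z^2 + 1)\<close>, the analogue with a single factor, the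
  block with eigenvalue 1 whose numerical range is the disc inscribed in the sector attains \<open>sqrt 2\<close>.
  Both sides are linear in the real inner products of the \<open>v j\<close>, so the identity only compares
  coefficients.
\<close>

lemma certificate_identity:
  fixes T :: "'a::complex_hilbert_space \<Rightarrow>\<^sub>L 'a" and k :: real
  defines "m \<equiv> k\<^sup>2 - 2"
  assumes v: "T v0 = v1" "T v1 = v2" "T v2 = v3" "T v3 = v4"
  assumes f: "f0 = (v0 + v3, 0)" "f1 = (0, v0 - v3)" "f2 = (v1 + v2, 0)" "f3 = (0, v1 - v2)"
  shows "k\<^sup>2 * ((norm (v4 + v0))\<^sup>2 + m\<^sup>2 * (norm v2)\<^sup>2 + 6 * m * rdot (v4 + v0) v2
            - (norm (v4 - (2 * k) *\<^sub>R v3 + (k\<^sup>2 + 2) *\<^sub>R v2 - (2 * k) *\<^sub>R v1 + v0))\<^sup>2)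
       = 2 * certificate k (sector_form T) f0 f1 f2 f3"
proof -
  have comm: "rdot v1 v0 = rdot v0 v1" "rdot v2 v0 = rdot v0 v2" "rdot v3 v0 = rdot v0 v3"
    "rdot v4 v0 = rdot v0 v4" "rdot v2 v1 = rdot v1 v2" "rdot v3 v1 = rdot v1 v3"
    "rdot v4 v1 = rdot v1 v4" "rdot v3 v2 = rdot v2 v3" "rdot v4 v2 = rdot v2 v4"
    "rdot v4 v3 = rdot v3 v4"
    by (rule rdot_commute)+
  show ?thesis
    unfolding m_def rdot_self[symmetric] certificate_def Let_def
    by (simp add: f sector_form_def blinfun.add_right blinfun.diff_right v rdot_simps comm) algebra
qed

text \<open>
  Block elimination of \<open>f0, f1\<close>: \<open>g\<close> and \<open>h\<close> are the first two rows of the coefficient matrix read as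
  combinations of the \<open>f j\<close>. They enter through the adjugate of the leading 2 by 2 block, whose determinant
  is \<open>k^6 - 8 m\<^sup>2\<close>. The last term is the Schur complement times this determinant. Both summands have the
  shape treated in \<open>sector_form_pair_nonneg\<close>.
\<close>

lemma certificate_schur_identity:
  fixes T :: "'a::complex_hilbert_space \<Rightarrow>\<^sub>L 'a" and k :: real
  defines "m \<equiv> k\<^sup>2 - 2"
  defines "\<phi> \<equiv> sector_form T"
  assumes g: "g = (k^3 - 2 * m) *\<^sub>R f0 + (2 * m) *\<^sub>R f1 + (k\<^sup>2 * (k - 2)) *\<^sub>R f2 - (k\<^sup>2 * m) *\<^sub>R f3"
    and h: "h = (2 * m) *\<^sub>R f0 + (k^3 + 2 * m) *\<^sub>R f1 + (k\<^sup>2 * m) *\<^sub>R f2 - (k\<^sup>2 * (k + 2)) *\<^sub>R f3"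
  shows "(k^6 - 8 * m\<^sup>2) * certificate k \<phi> f0 f1 f2 f3
   = ((k^3 + 2 * m) * \<phi> g g + (- 2 * m) * (\<phi> g h + \<phi> h g) + (k^3 - 2 * m) * \<phi> h h)
     + 8 * m * ((k^3 * (k\<^sup>2 + 2) + (- 4 * (k^4 - 2 * k\<^sup>2 + 2))) * \<phi> f2 f2
       + 8 * (k\<^sup>2 - 1) * (\<phi> f2 f3 + \<phi> f3 f2)
       + (k^3 * (k\<^sup>2 + 2) - (- 4 * (k^4 - 2 * k\<^sup>2 + 2))) * \<phi> f3 f3)"
  unfolding m_def \<phi>_def g h certificate_def Let_def
  by (simp only: sector_form_simps) algebra

lemma certificate_nonneg:
  fixes T :: "'a::complex_hilbert_space \<Rightarrow>\<^sub>L 'a"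
  assumes T: "quarter_sectorial T" and m: "0 < m"
  shows "0 \<le> (norm (T (T (T (T w))) + w))\<^sup>2 + m\<^sup>2 * (norm (T (T w)))\<^sup>2
              + 6 * m * rdot (T (T (T (T w))) + w) (T (T w))" (is "0 \<le> ?E")
proof -
  define k where "k = sqrt (m + 2)"
  have k2: "k\<^sup>2 = m + 2" and k: "0 < k"
    using m by (simp_all add: k_def)
  have m_eq: "m = k\<^sup>2 - 2"
    by (simp add: k2)
  define v1 v2 v3 v4 where "v1 = T w" and "v2 = T v1" and "v3 = T v2" and "v4 = T v3"
  define f0 f1 f2 f3 where "f0 = (w + v3, 0 :: 'a)" and "f1 = (0 :: 'a, w - v3)"
    and "f2 = (v1 + v2, 0 :: 'a)" and "f3 = (0 :: 'a, v1 - v2)"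
  define g h where "g = (k^3 - 2 * m) *\<^sub>R f0 + (2 * m) *\<^sub>R f1 + (k\<^sup>2 * (k - 2)) *\<^sub>R f2 - (k\<^sup>2 * m) *\<^sub>R f3"
    and "h = (2 * m) *\<^sub>R f0 + (k^3 + 2 * m) *\<^sub>R f1 + (k\<^sup>2 * m) *\<^sub>R f2 - (k\<^sup>2 * (k + 2)) *\<^sub>R f3"
  let ?\<phi> = "sector_form T"
  let ?r = "v4 - (2 * k) *\<^sub>R v3 + (k\<^sup>2 + 2) *\<^sub>R v2 - (2 * k) *\<^sub>R v1 + w"
  have k6: "k^6 = (m + 2)^3"
    using k2 by (simp flip: power_mult k2)
  have \<Delta>: "0 < k^6 - 8 * m\<^sup>2"
  proof -
    have "k^6 - 8 * m\<^sup>2 = m * (m - 1)\<^sup>2 + 11 * m + 8"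
      unfolding k6 by algebra
    then show ?thesis
      using m by (simp add: add_nonneg_pos)
  qed
  define N\<^sub>1 where "N\<^sub>1 = (k^3 + 2 * m) * ?\<phi> g g + (- 2 * m) * (?\<phi> g h + ?\<phi> h g) + (k^3 - 2 * m) * ?\<phi> h h"
  have block1: "0 \<le> N\<^sub>1"
    unfolding N\<^sub>1_def
  proof (rule sector_form_pair_nonneg[OF T])
    show "(2 * m)\<^sup>2 + (- 2 * m)\<^sup>2 \<le> (k^3)\<^sup>2"
      using \<Delta> by (simp add: power2_eq_square flip: power_mult power_add)
  qed (use k in simp)
  define N\<^sub>2 where "N\<^sub>2 = (k^3 * (k\<^sup>2 + 2) + (- 4 * (k^4 - 2 * k\<^sup>2 + 2))) * ?\<phi> f2 f2
       + 8 * (k\<^sup>2 - 1) * (?\<phi> f2 f3 + ?\<phi> f3 f2)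
       + (k^3 * (k\<^sup>2 + 2) - (- 4 * (k^4 - 2 * k\<^sup>2 + 2))) * ?\<phi> f3 f3"
  have block2: "0 \<le> N\<^sub>2"
    unfolding N\<^sub>2_def
  proof (rule sector_form_pair_nonneg[OF T])
    \<comment> \<open>The determinant of the Schur complement contains that of the leading block as a factor.\<close>
    have "(k^3 * (k\<^sup>2 + 2))\<^sup>2 - ((- 4 * (k^4 - 2 * k\<^sup>2 + 2))\<^sup>2 + (8 * (k\<^sup>2 - 1))\<^sup>2) = m\<^sup>2 * (k^6 - 8 * m\<^sup>2)"
      unfolding m_eq by algebra
    moreover have "0 \<le> m\<^sup>2 * (k^6 - 8 * m\<^sup>2)"
      using \<Delta> by simp
    ultimately show "(- 4 * (k^4 - 2 * k\<^sup>2 + 2))\<^sup>2 + (8 * (k\<^sup>2 - 1))\<^sup>2 \<le> (k^3 * (k\<^sup>2 + 2))\<^sup>2"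
      by linarith
  qed (use k in simp)
  have "(k^6 - 8 * m\<^sup>2) * (k\<^sup>2 * (?E - (norm ?r)\<^sup>2)) =
     2 * (N\<^sub>1 + 8 * m * N\<^sub>2)"
    using certificate_identity[of T w v1 v2 v3 v4 f0 f1 f2 f3 k, folded m_eq]
      certificate_schur_identity[of g k f0 f1 f2 f3 h T, folded m_eq]
    by (simp only: f0_def[symmetric] f1_def[symmetric] f2_def[symmetric] f3_def[symmetric]
        g_def[symmetric] h_def[symmetric] v1_def[symmetric] v2_def[symmetric] v3_def[symmetric]
        v4_def[symmetric] N\<^sub>1_def[symmetric] N\<^sub>2_def[symmetric] simp_thms mult.left_commute[of _ 2])
  also have "0 \<le> \<dots>"
    using block1 block2 m by (intro mult_nonneg_nonneg add_nonneg_nonneg) auto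
  finally have "0 \<le> ?E - (norm ?r)\<^sup>2"
    using \<Delta> k by (simp add: zero_le_mult_iff)
  then show ?thesis
    by (smt (verit) zero_le_power2)
qed

lemma norm_add_diff_combination:
  "(norm p)\<^sup>2 + (norm q)\<^sup>2 + 6 * rdot p q = 2 * (norm (p + q))\<^sup>2 - (norm (p - q))\<^sup>2"
  unfolding rdot_self[symmetric] by (simp add: rdot_simps rdot_commute[of q p])

text \<open>
  The substitution \<open>T \<mapsto> c T\<close> with \<open>c^4 = 1 / \<rho>\<close> reduces the constant term \<open>\<rho>\<close> to 1, at the price of
  replacing \<open>\<sigma>\<close> by \<open>\<sigma> c\<^sup>2\<close>.
\<close>

lemma quartic_norm_le:
  fixes T :: "'a::complex_hilbert_space \<Rightarrow>\<^sub>L 'a"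
  assumes T: "quarter_sectorial T" and \<sigma>: "0 < \<sigma>" and \<rho>: "0 < \<rho>"
  shows "norm (T (T (T (T w))) - \<sigma> *\<^sub>R T (T w) + \<rho> *\<^sub>R w)
     \<le> sqrt 2 * norm (T (T (T (T w))) + \<sigma> *\<^sub>R T (T w) + \<rho> *\<^sub>R w)"
proof -
  define c where "c = root 4 (1 / \<rho>)"
  have c: "0 < c" "c^4 = 1 / \<rho>"
    using \<rho> by (simp_all add: c_def)
  define m where "m = \<sigma> * c\<^sup>2"
  \<comment> \<open>The factor \<open>\<rho>\<close> absorbs \<open>c^4 = 1 / \<rho>\<close>, so that no constant is left in front of \<open>T^4 w\<close>.\<close>
  define x where "x = \<rho> *\<^sub>R w"
  have "0 < m"
    using c \<sigma> by (simp add: m_def)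
  let ?p = "T (T (T (T w))) + \<rho> *\<^sub>R w" and ?q = "\<sigma> *\<^sub>R T (T w)"
  let ?S = "c *\<^sub>R T"
  have S4: "?S (?S (?S (?S x))) + x = ?p"
    using c \<rho> by (simp add: x_def blinfun.scaleR_left blinfun.scaleR_right power4_eq_xxxx mult.assoc)
  have "c\<^sup>2 * c\<^sup>2 * \<rho> = 1"
    using c \<rho> by (simp flip: power_add)
  then have S2: "m *\<^sub>R ?S (?S x) = ?q"
    by (simp add: m_def x_def blinfun.scaleR_left blinfun.scaleR_right power2_eq_square mult_ac)
  have "0 \<le> (norm (?S (?S (?S (?S x))) + x))\<^sup>2 + m\<^sup>2 * (norm (?S (?S x)))\<^sup>2
              + 6 * m * rdot (?S (?S (?S (?S x))) + x) (?S (?S x))"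
    using certificate_nonneg[OF quarter_sectorial_scaleR[OF T] \<open>0 < m\<close>, of c x] c by simp
  also have "\<dots> = (norm ?p)\<^sup>2 + (norm (m *\<^sub>R ?S (?S x)))\<^sup>2 + 6 * rdot ?p (m *\<^sub>R ?S (?S x))"
    unfolding S4 by (simp only: norm_scaleR rdot_scaleR_right power_mult_distrib power2_abs mult.assoc)
  also have "\<dots> = 2 * (norm (?p + ?q))\<^sup>2 - (norm (?p - ?q))\<^sup>2"
    unfolding S2 by (rule norm_add_diff_combination)
  finally have "(norm (?p - ?q))\<^sup>2 \<le> (sqrt 2 * norm (?p + ?q))\<^sup>2"
    by (simp add: power_mult_distrib)
  then have "norm (?p - ?q) \<le> sqrt 2 * norm (?p + ?q)"
    by (rule power2_le_imp_le) simp
  moreover have "T (T (T (T w))) - \<sigma> *\<^sub>R T (T w) + \<rho> *\<^sub>R w = ?p - ?q"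
    "T (T (T (T w))) + \<sigma> *\<^sub>R T (T w) + \<rho> *\<^sub>R w = ?p + ?q"
    by simp_all
  ultimately show ?thesis
    by (simp only:)
qed

section \<open>Invertibility by continuation\<close>

lemma op_inverse_eqI:
  assumes "A o\<^sub>L B = id_blinfun" "B o\<^sub>L A = id_blinfun"
  shows "op_inverse A = B"
  unfolding op_inverse_def
proof (rule the_equality)
  fix C assume C: "A o\<^sub>L C = id_blinfun \<and> C o\<^sub>L A = id_blinfun"
  show "C = B"
  proof (rule blinfun_eqI)
    fix x
    have "B (A (C x)) = C x" "A (C x) = x"
      using assms(2) C by (metis blinfun_apply_blinfun_compose id_blinfun.rep_eq)+
    then show "C x = B x"
      by simp
  qed
qed (use assms in simp)

lemma op_inverse:
  assumes "invertible_op A"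
  shows "A o\<^sub>L op_inverse A = id_blinfun" "op_inverse A o\<^sub>L A = id_blinfun"
  using assms op_inverse_eqI unfolding invertible_op_def by metis+

lemma invertible_opI:
  fixes A :: "'a::real_normed_vector \<Rightarrow>\<^sub>L 'a"
  assumes below: "\<And>x. norm x \<le> C * norm (A x)" and surj: "surj (blinfun_apply A)"
  shows "invertible_op A"
proof -
  have inj: "inj (blinfun_apply A)"
  proof (rule injI)
    fix x y assume "A x = A y"
    then have "norm (x - y) \<le> 0"
      using below[of "x - y"] by (simp add: blinfun.diff_right)
    then show "x = y" by simp
  qed
  define g where "g = inv (blinfun_apply A)"
  have Ag: "A (g y) = y" for y
    by (simp add: g_def surj_f_inv_f[OF surj])
  have gA: "g (A x) = x" for x
    by (simp add: g_def inv_f_f[OF inj])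
  have "bounded_linear g"
  proof (rule bounded_linear_intro[where K = C])
    show "g (x + y) = g x + g y" for x y
      by (rule injD[OF inj]) (simp add: Ag blinfun.add_right)
    show "g (r *\<^sub>R x) = r *\<^sub>R g x" for r x
      by (rule injD[OF inj]) (simp add: Ag blinfun.scaleR_right)
    show "norm (g x) \<le> norm x * C" for x
      using below[of "g x"] by (simp add: Ag mult.commute)
  qed
  then have app: "blinfun_apply (Blinfun g) = g"
    by (rule bounded_linear_Blinfun_apply)
  show ?thesis
    unfolding invertible_op_def
    by (rule exI[of _ "Blinfun g"]) (auto intro!: blinfun_eqI simp: app Ag gA)
qed

text \<open>
  Solving \<open>B x = y\<close> amounts to \<open>A x = y - (B - A) x\<close>, a fixed point equation for \<open>x\<close> whose right-hand side is a
  contraction after application of the inverse of \<open>A\<close>.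
\<close>

lemma surj_perturbation:
  fixes A B :: "'a::banach \<Rightarrow>\<^sub>L 'a"
  assumes below: "\<And>x. norm x \<le> C * norm (A x)" and surj: "surj (blinfun_apply A)"
    and C: "0 \<le> C" and close: "C * norm (B - A) < 1"
  shows "surj (blinfun_apply B)"
  unfolding surj_def
proof
  fix y
  define g where "g = inv (blinfun_apply A)"
  have Ag: "A (g z) = z" for z
    by (simp add: g_def surj_f_inv_f[OF surj])
  define f where "f x = g (y - (B - A) x)" for x
  have "dist (f x) (f x') \<le> (C * norm (B - A)) * dist x x'" for x x'
  proof -
    have "A (f x - f x') = (B - A) (x' - x)"
      by (simp add: f_def Ag blinfun.diff_right)
    then have "norm (f x - f x') \<le> C * norm ((B - A) (x' - x))"
      using below[of "f x - f x'"] by simp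
    also have "\<dots> \<le> C * (norm (B - A) * norm (x' - x))"
      by (intro mult_left_mono norm_blinfun C)
    finally show ?thesis
      by (simp add: dist_norm norm_minus_commute mult.assoc)
  qed
  then have "\<exists>!x. f x = x"
    using banach_fix_type[of "C * norm (B - A)" f] C close by simp
  then obtain x where "f x = x" by blast
  then have "A x = y - (B - A) x"
    by (metis Ag f_def)
  then show "\<exists>x. y = B x"
    by (intro exI[of _ x]) (simp add: blinfun.diff_left)
qed

text \<open>
  The method of continuity. A lower bound that is uniform in \<open>s\<close>, together with uniform continuity, gives a
  fixed step size by which surjectivity can be propagated from 0 to 1.
\<close>

lemma surj_continuation:
  fixes A :: "real \<Rightarrow> 'a::banach \<Rightarrow>\<^sub>L 'a"
  assumes cont: "continuous_on {0..1} A"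
    and below: "\<And>s x. s \<in> {0..1} \<Longrightarrow> norm x \<le> C * norm (A s x)"
    and surj: "surj (blinfun_apply (A 0))" and C: "0 < C"
  shows "surj (blinfun_apply (A 1))"
proof -
  have "uniformly_continuous_on {0..1} A"
    using cont by (simp add: compact_uniformly_continuous)
  moreover have "0 < 1 / C"
    using C by simp
  ultimately obtain \<delta> where \<delta>: "0 < \<delta>"
    "\<And>s t. s \<in> {0..1} \<Longrightarrow> t \<in> {0..1} \<Longrightarrow> dist t s < \<delta> \<Longrightarrow> dist (A t) (A s) < 1 / C"
    unfolding uniformly_continuous_on_def by blast
  obtain n where n: "inverse (real (Suc n)) < \<delta>"
    using reals_Archimedean[OF \<delta>(1)] by blast
  have "j \<le> Suc n \<Longrightarrow> surj (blinfun_apply (A (real j / real (Suc n))))" for j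
  proof (induction j)
    case 0
    then show ?case using surj by simp
  next
    case (Suc j)
    let ?s = "real j / real (Suc n)" and ?t = "real (Suc j) / real (Suc n)"
    have st: "?s \<in> {0..1}" "?t \<in> {0..1}"
      using Suc.prems by (auto simp: divide_simps)
    have "?t - ?s = inverse (real (Suc n))"
      by (simp add: divide_simps)
    then have "dist ?t ?s < \<delta>"
      using n by (simp add: dist_real_def del: of_nat_Suc)
    then have "norm (A ?t - A ?s) < 1 / C"
      using \<delta>(2)[OF st] by (simp only: dist_norm)
    then have "C * norm (A ?t - A ?s) < 1"
      using C by (simp add: field_simps)
    with surj_perturbation[OF below[OF st(1)] Suc.IH] Suc.prems C show ?case
      by simp
  qed
  from this[of "Suc n"] show ?thesis
    by simp
qed

section \<open>The quartic operator\<close>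

definition quartic_op :: "('a::real_normed_vector \<Rightarrow>\<^sub>L 'a) \<Rightarrow> real \<Rightarrow> real \<Rightarrow> 'a \<Rightarrow>\<^sub>L 'a" where
  "quartic_op T \<sigma> \<rho> = op_power T 4 + \<sigma> *\<^sub>R op_power T 2 + \<rho> *\<^sub>R id_blinfun"

lemma op_power_2: "op_power T 2 = T o\<^sub>L T"
  by (simp add: numeral_2_eq_2 blinfun_eqI)

lemma op_power_4: "op_power T 4 = T o\<^sub>L (T o\<^sub>L (T o\<^sub>L T))"
  by (simp add: eval_nat_numeral blinfun_eqI)

lemma quartic_op_apply:
  "quartic_op T \<sigma> \<rho> x = T (T (T (T x))) + \<sigma> *\<^sub>R T (T x) + \<rho> *\<^sub>R x"
  by (simp add: quartic_op_def op_power_2 op_power_4 blinfun.add_left blinfun.scaleR_left)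

lemma quartic_op_minus_le:
  fixes T :: "'a::complex_hilbert_space \<Rightarrow>\<^sub>L 'a"
  assumes T: "quarter_sectorial T" and "0 < \<sigma>" "0 < \<rho>"
  shows "norm (quartic_op T (- \<sigma>) \<rho> x) \<le> sqrt 2 * norm (quartic_op T \<sigma> \<rho> x)"
  using quartic_norm_le[OF assms, of x] by (simp add: quartic_op_apply)

text \<open>
  The estimate controls \<open>T^4 x - \<sigma> T^2 x + \<rho> x\<close> by \<open>T^4 x + \<sigma> T^2 x + \<rho> x\<close>, hence it controls both
  \<open>\<sigma> T^2 x\<close> and \<open>T^4 x + \<rho> x\<close>, which are half the difference and half the sum. The first bounds
  \<open>T^4 x\<close> as well, so \<open>\<rho> x\<close> is bounded too. The constant uses \<open>sqrt 2 \<le> 2\<close> and is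
  increasing in \<open>norm T\<close>, which makes it uniform along the path \<open>s T\<close>.
\<close>

lemma quartic_op_bounded_below:
  fixes T :: "'a::complex_hilbert_space \<Rightarrow>\<^sub>L 'a"
  assumes T: "quarter_sectorial T" and \<sigma>: "0 < \<sigma>" and \<rho>: "0 < \<rho>"
  shows "norm x \<le> (3 / 2 * (1 + (norm T)\<^sup>2 / \<sigma>) / \<rho>) * norm (quartic_op T \<sigma> \<rho> x)"
proof -
  let ?N = "quartic_op T \<sigma> \<rho> x" and ?M = "quartic_op T (- \<sigma>) \<rho> x"
  have "sqrt 2 \<le> 2"
    by (rule real_le_lsqrt) auto
  then have M: "norm ?M \<le> 2 * norm ?N"
    using quartic_op_minus_le[OF assms, of x] mult_right_mono[of "sqrt 2" 2 "norm ?N"] by simp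
  have two: "2 *\<^sub>R v = v + v" for v :: 'a
    by (simp add: scaleR_2)
  have "(2 * \<sigma>) *\<^sub>R T (T x) = ?N - ?M"
    by (simp add: quartic_op_apply two flip: scaleR_scaleR)
  then have "norm ((2 * \<sigma>) *\<^sub>R T (T x)) \<le> norm ?N + norm ?M"
    by (simp only: norm_triangle_ineq4)
  then have "2 * \<sigma> * norm (T (T x)) \<le> 3 * norm ?N"
    using M \<sigma> by (simp add: abs_mult)
  then have q: "norm (T (T x)) \<le> 3 / 2 * norm ?N / \<sigma>"
    using \<sigma> by (simp add: field_simps)
  have "2 *\<^sub>R (T (T (T (T x))) + \<rho> *\<^sub>R x) = ?N + ?M"
    by (simp add: quartic_op_apply two)
  then have "2 * norm (T (T (T (T x))) + \<rho> *\<^sub>R x) \<le> norm ?N + norm ?M"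
    by (metis abs_numeral norm_scaleR norm_triangle_ineq)
  then have p: "norm (T (T (T (T x))) + \<rho> *\<^sub>R x) \<le> 3 / 2 * norm ?N"
    using M by simp
  have "norm (T (T (T (T x)))) \<le> norm T * (norm T * norm (T (T x)))"
    by (meson mult_left_mono norm_blinfun norm_ge_zero order_trans)
  also have "\<dots> \<le> (norm T)\<^sup>2 * (3 / 2 * norm ?N / \<sigma>)"
    unfolding power2_eq_square mult.assoc[symmetric] by (intro mult_left_mono q) simp
  finally have "\<rho> * norm x \<le> 3 / 2 * norm ?N + (norm T)\<^sup>2 * (3 / 2 * norm ?N / \<sigma>)"
    using norm_triangle_ineq4[of "T (T (T (T x))) + \<rho> *\<^sub>R x" "T (T (T (T x)))"] p \<rho> by simp
  also have "\<dots> = \<rho> * ((3 / 2 * (1 + (norm T)\<^sup>2 / \<sigma>) / \<rho>) * norm ?N)"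
    using \<rho> \<sigma> by (simp add: field_simps)
  finally show ?thesis
    using \<rho> by (simp only: mult_le_cancel_left_pos)
qed

lemma invertible_quartic_op:
  fixes T :: "'a::complex_hilbert_space \<Rightarrow>\<^sub>L 'a"
  assumes T: "quarter_sectorial T" and \<sigma>: "0 < \<sigma>" and \<rho>: "0 < \<rho>"
  shows "invertible_op (quartic_op T \<sigma> \<rho>)"
proof (rule invertible_opI)
  let ?C = "3 / 2 * (1 + (norm T)\<^sup>2 / \<sigma>) / \<rho>"
  let ?A = "\<lambda>s. quartic_op (s *\<^sub>R T) \<sigma> \<rho>"
  have C: "0 < ?C"
    using \<sigma> \<rho> by (intro divide_pos_pos mult_pos_pos add_pos_nonneg) auto
  have below: "norm x \<le> ?C * norm (?A s x)" if s: "s \<in> {0..1}" for s x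
  proof -
    have "norm (s *\<^sub>R T) \<le> norm T"
      using s by (simp add: mult_left_le_one_le)
    then have "(norm (s *\<^sub>R T))\<^sup>2 \<le> (norm T)\<^sup>2"
      by (rule power_mono) simp
    then have "3 / 2 * (1 + (norm (s *\<^sub>R T))\<^sup>2 / \<sigma>) / \<rho> \<le> ?C"
      using \<sigma> \<rho> by (intro divide_right_mono mult_left_mono add_left_mono) auto
    then have "3 / 2 * (1 + (norm (s *\<^sub>R T))\<^sup>2 / \<sigma>) / \<rho> * norm (?A s x) \<le> ?C * norm (?A s x)"
      by (rule mult_right_mono) simp
    moreover have "quarter_sectorial (s *\<^sub>R T)"
      using T s by (simp add: quarter_sectorial_scaleR)
    ultimately show ?thesis
      using quartic_op_bounded_below[of "s *\<^sub>R T" \<sigma> \<rho> x] \<sigma> \<rho> by (meson order_trans)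
  qed
  have A: "?A s = s^4 *\<^sub>R op_power T 4 + (\<sigma> * s\<^sup>2) *\<^sub>R op_power T 2 + \<rho> *\<^sub>R id_blinfun" for s
    by (rule blinfun_eqI)
      (simp add: quartic_op_apply op_power_2 op_power_4 blinfun.add_left blinfun.scaleR_left
        blinfun.scaleR_right power2_eq_square power4_eq_xxxx mult.assoc)
  have "continuous_on {0..1} ?A"
    unfolding A by (intro continuous_intros)
  moreover have "surj (blinfun_apply (?A 0))"
  proof (rule surjI)
    show "?A 0 ((1 / \<rho>) *\<^sub>R y) = y" for y
      using \<rho> by (simp add: quartic_op_apply)
  qed
  ultimately have "surj (blinfun_apply (?A 1))"
    using below C by (intro surj_continuation[of ?A ?C]) auto
  then show "surj (blinfun_apply (quartic_op T \<sigma> \<rho>))"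
    by simp
  show "norm x \<le> ?C * norm (quartic_op T \<sigma> \<rho> x)" for x
    by (rule quartic_op_bounded_below[OF assms])
qed

lemma norm_quartic_quotient_le:
  fixes T :: "'a::complex_hilbert_space \<Rightarrow>\<^sub>L 'a"
  assumes "quarter_sectorial T" "0 < \<sigma>" "0 < \<rho>"
  shows "norm (quartic_op T (- \<sigma>) \<rho> o\<^sub>L op_inverse (quartic_op T \<sigma> \<rho>)) \<le> sqrt 2"
proof (rule norm_blinfun_bound)
  fix x
  let ?y = "op_inverse (quartic_op T \<sigma> \<rho>) x"
  have "quartic_op T \<sigma> \<rho> ?y = x"
    using op_inverse(1)[OF invertible_quartic_op[OF assms]]
    by (metis blinfun_apply_blinfun_compose id_blinfun.rep_eq)
  then show "norm ((quartic_op T (- \<sigma>) \<rho> o\<^sub>L op_inverse (quartic_op T \<sigma> \<rho>)) x) \<le> sqrt 2 * norm x"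
    using quartic_op_minus_le[OF assms, of ?y] by simp
qed simp


section \<open>The rational functional calculus\<close>

lemma scaleC_zero_left: "(0::complex) *\<^sub>C x = (0 :: 'a::complex_hilbert_space)"
  using scaleR_scaleC[of 0 x] by simp

lemma scaleC_zero_right: "c *\<^sub>C (0 :: 'a::complex_hilbert_space) = 0"
  by (metis add_cancel_right_right scaleC_add_right)

lemma scaleC_one: "1 *\<^sub>C x = (x :: 'a::complex_hilbert_space)"
  using scaleR_scaleC[of 1 x] by simp

lemma scaleC_op_simps:
  fixes X Y :: "'a::complex_hilbert_space \<Rightarrow>\<^sub>L 'a"
  shows "scaleC_op 0 X = 0" "scaleC_op 1 X = X"
    "scaleC_op (a + b) X = scaleC_op a X + scaleC_op b X"
    "scaleC_op (complex_of_real r) X = r *\<^sub>R X"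
    "scaleC_op a (X + Y) = scaleC_op a X + scaleC_op a Y"
    "scaleC_op a (scaleC_op b X) = scaleC_op (a * b) X"
    "scaleC_op a (0 :: 'a \<Rightarrow>\<^sub>L 'a) = 0"
    "scaleC_op a X o\<^sub>L Y = scaleC_op a (X o\<^sub>L Y)"
  by (auto intro!: blinfun_eqI simp: scaleC_op.rep_eq blinfun.add_left blinfun.scaleR_left
      scaleC_zero_left scaleC_zero_right scaleC_one scaleC_add_left scaleC_add_right scaleC_scaleC
      scaleR_scaleC)

lemma compose_scaleC_op:
  assumes "clinear_op A"
  shows "A o\<^sub>L scaleC_op c X = scaleC_op c (A o\<^sub>L X)"
  using assms by (auto intro!: blinfun_eqI simp: scaleC_op.rep_eq clinear_op_def)

lemma blinfun_compose_sum_right: "A o\<^sub>L (\<Sum>i\<in>I. f i) = (\<Sum>i\<in>I. A o\<^sub>L f i)"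
  by (rule blinfun_eqI) (simp add: blinfun.sum_left blinfun.sum_right)

lemma scaleC_op_sum: "scaleC_op c (\<Sum>i\<in>I. f i) = (\<Sum>i\<in>I. scaleC_op c (f i))"
  by (induction I rule: infinite_finite_induct) (simp_all add: scaleC_op_simps)

text \<open>
  Summing up to a bound larger than the degree frees the linearity laws from the drop in degree when leading
  coefficients cancel.
\<close>

lemma poly_op_altdef:
  assumes "degree p \<le> n"
  shows "poly_op p A = (\<Sum>i\<le>n. scaleC_op (coeff p i) (op_power A i))"
  unfolding poly_op_def using assms
  by (intro sum.mono_neutral_left) (auto simp: coeff_eq_0 scaleC_op_simps)

lemma poly_op_0: "poly_op 0 A = 0"
  by (simp add: poly_op_def scaleC_op_simps)

lemma poly_op_add: "poly_op (p + q) A = poly_op p A + poly_op q A"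
proof -
  let ?n = "max (degree p) (degree q)"
  have "poly_op (p + q) A = (\<Sum>i\<le>?n. scaleC_op (coeff (p + q) i) (op_power A i))"
    by (rule poly_op_altdef) (rule degree_add_le_max)
  also have "\<dots> = poly_op p A + poly_op q A"
    by (simp add: poly_op_altdef[of p ?n] poly_op_altdef[of q ?n] scaleC_op_simps sum.distrib)
  finally show ?thesis .
qed

lemma poly_op_smult: "poly_op (smult c p) A = scaleC_op c (poly_op p A)"
  by (simp add: poly_op_altdef[of "smult c p" "degree p"] poly_op_def scaleC_op_sum scaleC_op_simps)

lemma poly_op_pCons:
  assumes "clinear_op A"
  shows "poly_op (pCons a p) A = scaleC_op a id_blinfun + (A o\<^sub>L poly_op p A)"
proof -
  have "poly_op (pCons a p) A
      = (\<Sum>i\<le>Suc (degree p). scaleC_op (coeff (pCons a p) i) (op_power A i))"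
    by (rule poly_op_altdef) (rule degree_pCons_le)
  also have "\<dots> = scaleC_op a id_blinfun + (A o\<^sub>L poly_op p A)"
    unfolding sum.atMost_Suc_shift poly_op_def
    by (simp add: blinfun_compose_sum_right compose_scaleC_op[OF assms])
  finally show ?thesis .
qed

lemma poly_op_mult:
  assumes A: "clinear_op A"
  shows "poly_op (p * q) A = poly_op p A o\<^sub>L poly_op q A"
proof (induction p)
  case 0
  then show ?case by (simp add: poly_op_0)
next
  case (pCons a p)
  have "poly_op (pCons a p * q) A = scaleC_op a (poly_op q A) + (A o\<^sub>L poly_op (p * q) A)"
    by (simp add: mult_pCons_left poly_op_add poly_op_smult poly_op_pCons[OF A] scaleC_op_simps)
  also have "\<dots> = (scaleC_op a id_blinfun + (A o\<^sub>L poly_op p A)) o\<^sub>L poly_op q A"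
    by (rule blinfun_eqI) (simp add: pCons.IH blinfun.add_left scaleC_op.rep_eq)
  finally show ?case
    by (simp add: poly_op_pCons[OF A])
qed

text \<open>
  Two representations \<open>p / q\<close> and \<open>r / s\<close> agree off finitely many points, so \<open>p s = r q\<close> as
  polynomials. Every vector has the form \<open>q(A) s(A) y\<close>, and on it the two operators give
  \<open>p(A) s(A) y\<close> and \<open>r(A) q(A) y\<close>.
\<close>

lemma rational_value_unique:
  assumes A: "clinear_op A" and B: "rational_value F A B" and C: "rational_value F A C"
  shows "B = C"
proof -
  obtain p q where pq: "q \<noteq> 0" "\<And>z. poly q z \<noteq> 0 \<Longrightarrow> F z = poly p z / poly q z"
    "invertible_op (poly_op q A)" "B = poly_op p A o\<^sub>L op_inverse (poly_op q A)"
    using B unfolding rational_value_def by blast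
  obtain r s where rs: "s \<noteq> 0" "\<And>z. poly s z \<noteq> 0 \<Longrightarrow> F z = poly r z / poly s z"
    "invertible_op (poly_op s A)" "C = poly_op r A o\<^sub>L op_inverse (poly_op s A)"
    using C unfolding rational_value_def by blast
  have "poly ((p * s - r * q) * (q * s)) z = 0" for z
  proof (cases "poly q z = 0 \<or> poly s z = 0")
    case False
    then have "poly p z / poly q z = poly r z / poly s z"
      using pq(2) rs(2) by metis
    with False show ?thesis
      by (simp add: field_simps)
  qed auto
  then have "(p * s - r * q) * (q * s) = 0"
    by (simp flip: poly_all_0_iff_0)
  with pq(1) rs(1) have ps: "p * s = r * q"
    by simp
  let ?P = "poly_op p A" and ?Q = "poly_op q A" and ?R = "poly_op r A" and ?S = "poly_op s A"
  have inverse_apply: "X (op_inverse X x) = x" "op_inverse X (X x) = x"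
    if "invertible_op X" for X :: "'a \<Rightarrow>\<^sub>L 'a" and x
    using op_inverse[OF that] by (metis blinfun_apply_blinfun_compose id_blinfun.rep_eq)+
  have PS: "?P (?S y) = ?R (?Q y)" and QS: "?Q (?S y) = ?S (?Q y)" for y
    using poly_op_mult[OF A, of p s] poly_op_mult[OF A, of r q] ps
      poly_op_mult[OF A, of q s] poly_op_mult[OF A, of s q]
    by (metis blinfun_apply_blinfun_compose mult.commute)+
  show "B = C"
  proof (rule blinfun_eqI)
    fix x
    define y where "y = op_inverse ?S (op_inverse ?Q x)"
    have x: "x = ?Q (?S y)"
      by (simp add: y_def inverse_apply pq(3) rs(3))
    have "B x = ?P (?S y)"
      by (simp add: x pq(4) inverse_apply pq(3))
    also have "\<dots> = ?R (?Q y)"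
      by (rule PS)
    also have "\<dots> = C x"
      unfolding x QS by (simp add: rs(4) inverse_apply rs(3))
    finally show "B x = C x" .
  qed
qed

lemma apply_op_eqI:
  assumes "clinear_op A" "rational_value F A B"
  shows "apply_op F A = B"
  unfolding apply_op_def using assms rational_value_unique by blast

section \<open>Blaschke products of degree two\<close>

lemma blaschke2_real_quadratics:
  fixes \<zeta>\<^sub>1 \<zeta>\<^sub>2 :: complex
  assumes "Re \<zeta>\<^sub>1 > 0" "Re \<zeta>\<^sub>2 > 0" and "(\<zeta>\<^sub>1 \<in> \<real> \<and> \<zeta>\<^sub>2 \<in> \<real>) \<or> \<zeta>\<^sub>2 = cnj \<zeta>\<^sub>1"
  obtains \<sigma> \<rho> :: real where "0 < \<sigma>" "0 < \<rho>"
    "\<And>z :: complex. (z - \<zeta>\<^sub>1) * (z - \<zeta>\<^sub>2) = z\<^sup>2 - \<sigma> * z + \<rho>"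
    "\<And>z :: complex. (z + cnj \<zeta>\<^sub>1) * (z + cnj \<zeta>\<^sub>2) = z\<^sup>2 + \<sigma> * z + \<rho>"
  using assms(3)
proof
  assume "\<zeta>\<^sub>1 \<in> \<real> \<and> \<zeta>\<^sub>2 \<in> \<real>"
  then obtain r s where "\<zeta>\<^sub>1 = complex_of_real r" "\<zeta>\<^sub>2 = complex_of_real s"
    by (auto elim!: Reals_cases)
  with assms show thesis
    by (intro that[of "r + s" "r * s"]) (simp_all add: algebra_simps power2_eq_square)
next
  assume \<zeta>: "\<zeta>\<^sub>2 = cnj \<zeta>\<^sub>1"
  have sum: "complex_of_real (2 * Re \<zeta>\<^sub>1) = \<zeta>\<^sub>1 + cnj \<zeta>\<^sub>1"
    by (simp add: complex_add_cnj)
  have prod: "complex_of_real ((cmod \<zeta>\<^sub>1)\<^sup>2) = \<zeta>\<^sub>1 * cnj \<zeta>\<^sub>1"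
    by (rule complex_norm_square)
  show thesis
  proof (rule that[of "2 * Re \<zeta>\<^sub>1" "(cmod \<zeta>\<^sub>1)\<^sup>2"])
    show "0 < 2 * Re \<zeta>\<^sub>1" "0 < (cmod \<zeta>\<^sub>1)\<^sup>2"
      using assms(1) by auto
    fix z
    show "(z - \<zeta>\<^sub>1) * (z - \<zeta>\<^sub>2) = z\<^sup>2 - complex_of_real (2 * Re \<zeta>\<^sub>1) * z + complex_of_real ((cmod \<zeta>\<^sub>1)\<^sup>2)"
      "(z + cnj \<zeta>\<^sub>1) * (z + cnj \<zeta>\<^sub>2) = z\<^sup>2 + complex_of_real (2 * Re \<zeta>\<^sub>1) * z + complex_of_real ((cmod \<zeta>\<^sub>1)\<^sup>2)"
      unfolding \<zeta> sum prod by (simp_all add: algebra_simps power2_eq_square)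
  qed
qed

lemma blaschke2_sector_bound:
  fixes T :: "'a::complex_hilbert_space \<Rightarrow>\<^sub>L 'a"
  assumes lin: "clinear_op T" and T: "quarter_sectorial T" and \<omega>: "cmod \<omega> = 1"
    and \<zeta>: "Re \<zeta>\<^sub>1 > 0" "Re \<zeta>\<^sub>2 > 0" "(\<zeta>\<^sub>1 \<in> \<real> \<and> \<zeta>\<^sub>2 \<in> \<real>) \<or> \<zeta>\<^sub>2 = cnj \<zeta>\<^sub>1"
  shows "\<exists>B. rational_value (blaschke2 \<omega> \<zeta>\<^sub>1 \<zeta>\<^sub>2) (op_power T 2) B \<and> norm B \<le> sqrt 2"
proof -
  obtain \<sigma> \<rho> :: real where \<sigma>: "0 < \<sigma>" and \<rho>: "0 < \<rho>"
    and num: "\<And>z :: complex. (z - \<zeta>\<^sub>1) * (z - \<zeta>\<^sub>2) = z\<^sup>2 - \<sigma> * z + \<rho>"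
    and den: "\<And>z :: complex. (z + cnj \<zeta>\<^sub>1) * (z + cnj \<zeta>\<^sub>2) = z\<^sup>2 + \<sigma> * z + \<rho>"
    using blaschke2_real_quadratics[OF \<zeta>] by blast
  let ?S = "op_power T 2"
  have S: "clinear_op ?S"
    using lin by (simp add: clinear_op_def op_power_2)
  have quad: "poly_op [:complex_of_real \<rho>, complex_of_real s, 1:] ?S = quartic_op T s \<rho>" for s
    unfolding poly_op_pCons[OF S]
    by (rule blinfun_eqI)
      (simp add: poly_op_0 scaleC_op_simps quartic_op_apply op_power_2
        blinfun.add_left blinfun.add_right blinfun.scaleR_left blinfun.scaleR_right)
  let ?p = "smult \<omega> [:complex_of_real \<rho>, complex_of_real (- \<sigma>), 1:]"
  let ?q = "[:complex_of_real \<rho>, complex_of_real \<sigma>, 1:]"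
  let ?B = "quartic_op T (- \<sigma>) \<rho> o\<^sub>L op_inverse (quartic_op T \<sigma> \<rho>)"
  \<comment> \<open>At a pole both sides are 0 by the convention for division by 0.\<close>
  have quotient: "blaschke2 \<omega> \<zeta>\<^sub>1 \<zeta>\<^sub>2 z = poly ?p z / poly ?q z" for z
  proof -
    have "blaschke2 \<omega> \<zeta>\<^sub>1 \<zeta>\<^sub>2 z
        = \<omega> * ((z - \<zeta>\<^sub>1) * (z - \<zeta>\<^sub>2)) / ((z + cnj \<zeta>\<^sub>1) * (z + cnj \<zeta>\<^sub>2))"
      by (simp add: blaschke2_def)
    also have "\<dots> = poly ?p z / poly ?q z"
      unfolding num den by (simp add: algebra_simps power2_eq_square)
    finally show ?thesis .
  qed
  have "rational_value (blaschke2 \<omega> \<zeta>\<^sub>1 \<zeta>\<^sub>2) ?S (scaleC_op \<omega> ?B)"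
    unfolding rational_value_def
  proof (rule exI[of _ ?p], rule exI[of _ ?q], intro conjI)
    show "invertible_op (poly_op ?q ?S)"
      unfolding quad by (rule invertible_quartic_op[OF T \<sigma> \<rho>])
    show "scaleC_op \<omega> ?B = poly_op ?p ?S o\<^sub>L op_inverse (poly_op ?q ?S)"
      unfolding poly_op_smult quad by (simp only: scaleC_op_simps)
  qed (use quotient in auto)
  moreover have "norm (scaleC_op \<omega> ?B) \<le> sqrt 2"
  proof (rule norm_blinfun_bound)
    fix x
    have "norm (?B x) \<le> sqrt 2 * norm x"
      using norm_quartic_quotient_le[OF T \<sigma> \<rho>] norm_blinfun[of ?B x]
      by (meson mult_right_mono norm_ge_zero order_trans)
    then show "norm (scaleC_op \<omega> ?B x) \<le> sqrt 2 * norm x"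
      by (simp add: scaleC_op.rep_eq norm_scaleC \<omega>)
  qed simp
  ultimately show ?thesis
    by blast
qed

theorem theorem1p4:
  fixes T :: "'a::complex_hilbert_space \<Rightarrow>\<^sub>L 'a"
  assumes "clinear_op T"
    and "numerical_range T \<subseteq> sector (pi / 4)"
  shows "(\<forall>u>0.
            invertible_op (op_power T 4 + u *\<^sub>R op_power T 2 + id_blinfun) \<and>
            norm ((op_power T 4 - u *\<^sub>R op_power T 2 + id_blinfun) o\<^sub>L
                  op_inverse (op_power T 4 + u *\<^sub>R op_power T 2 + id_blinfun)) \<le> sqrt 2) \<and>
         (\<forall>\<omega> \<zeta>\<^sub>1 \<zeta>\<^sub>2. cmod \<omega> = 1 \<longrightarrow> Re \<zeta>\<^sub>1 > 0 \<longrightarrow> Re \<zeta>\<^sub>2 > 0 \<longrightarrow>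
            (\<zeta>\<^sub>1 \<in> \<real> \<and> \<zeta>\<^sub>2 \<in> \<real>) \<or> \<zeta>\<^sub>2 = cnj \<zeta>\<^sub>1 \<longrightarrow>
            (\<exists>B. rational_value (blaschke2 \<omega> \<zeta>\<^sub>1 \<zeta>\<^sub>2) (op_power T 2) B) \<and>
            norm (apply_op (blaschke2 \<omega> \<zeta>\<^sub>1 \<zeta>\<^sub>2) (op_power T 2)) \<le> sqrt 2)"
proof -
  have T: "quarter_sectorial T"
    using assms by (rule quarter_sectorialI)
  have "clinear_op (op_power T 2)"
    using assms(1) by (simp add: clinear_op_def op_power_2)
  then have "apply_op F (op_power T 2) = B" if "rational_value F (op_power T 2) B" for F B
    using that by (rule apply_op_eqI)
  then show ?thesis
    using invertible_quartic_op[OF T _ zero_less_one] norm_quartic_quotient_le[OF T _ zero_less_one]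
      blaschke2_sector_bound[OF assms(1) T]
    unfolding quartic_op_def by (simp, metis)
qed

end
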